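(* Let $\mathcal{M}$ be an arbitrary Lipschitz manifold in $\mathbb{R}^n$ of dimension $\dim\mathcal{M}$. Then for every $v\ge1$, $$\dim\big(\mathcal{M}\cap\mathcal{S}^*_n(v)\big)\ \ge\ \dim\mathcal{M}-1+\frac{2}{1+v}.$$
   Context: On the left-hand side $\dim$ denotes Hausdorff dimension; $\dim\mathcal{M}$ is the dimension of the manifold $\mathcal{M}$. For $x\in\mathbb{R}$ put $\|x\|=\min\{|x-m|:m\in\mathbb{Z}\}$. For $v>0$, $\mathcal{S}^*_n(v)$ is the set of $(y_1,\dots,y_n)\in\mathbb{R}^n$ for which there are infinitely many $q\in\mathbb{N}$ such that $\prod_{i=1}^n\|qy_i\|<q^{-v}$. A Lipschitz manifold in $\mathbb{R}^n$ is a (non-empty) manifold $\mathcal{M}\subset\mathbb{R}^n$ for which there exists an atlas of Lipschitz maps: with $m=\dim\mathcal{M}$, every point of $\mathcal{M}$ has a relatively open neighbourhood in $\mathcal{M}$ carrying a chart, i.e. a homeomorphism onto an open subset of $\mathbb{R}^m$, that is a Lipschitz map with respect to the Euclidean metrics. *)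

theory Defs
  imports "HOL-Analysis.Analysis"
begin

(* diam(U)^s with the usual conventions 0^0 = 1 for nonempty U and value 0 for U = {}.
   The case s = 0 is separate because 0 powr 0 = 0. *)
definition diam_powr :: "real \<Rightarrow> 'a::metric_space set \<Rightarrow> ennreal" where
  "diam_powr s U =
     (if U = {} then 0 else if s = 0 then 1 else ennreal (diameter U powr s))"

(* Boundedness is required explicitly since diameter is unspecified on unbounded sets.
   Finite covers are included by padding with empty sets. *)
definition hausdorff_pre :: "real \<Rightarrow> real \<Rightarrow> 'a::metric_space set \<Rightarrow> ennreal" where
  "hausdorff_pre \<delta> s A =
     Inf {(\<Sum>i. diam_powr s (U i)) | U :: nat \<Rightarrow> 'a set.
            A \<subseteq> (\<Union>i. U i) \<and> (\<forall>i. bounded (U i) \<and> diameter (U i) \<le> \<delta>)}"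

definition hausdorff_measure :: "real \<Rightarrow> 'a::metric_space set \<Rightarrow> ennreal" where
  "hausdorff_measure s A = (SUP \<delta>\<in>{0<..}. hausdorff_pre \<delta> s A)"

(* In particular the empty set has dimension 0. *)
definition hausdorff_dim :: "'a::metric_space set \<Rightarrow> ereal" where
  "hausdorff_dim A = Inf {ereal s | s. 0 \<le> s \<and> hausdorff_measure s A = 0}"

definition dist_int :: "real \<Rightarrow> real" where
  "dist_int x = (INF m::int. \<bar>x - of_int m\<bar>)"

definition mult_approx :: "real \<Rightarrow> (real ^ 'n) set" where
  "mult_approx v =
     {y. infinite {q::nat. 0 < q \<and> (\<Prod>i\<in>UNIV. dist_int (real q * y $ i)) < real q powr (- v)}}"

(* Euclidean_space m models R^m as the sequences vanishing from index m on, so the L2_set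
   term is the Euclidean distance. A chart is only required to be Lipschitz itself;
   nothing is assumed about its inverse beyond continuity. *)
definition lipschitz_chart ::
  "nat \<Rightarrow> 'a::metric_space set \<Rightarrow> 'a set \<Rightarrow> ('a \<Rightarrow> nat \<Rightarrow> real) \<Rightarrow> bool" where
  "lipschitz_chart m M U \<phi> \<longleftrightarrow>
     openin (top_of_set M) U \<and>
     (\<exists>V. openin (Euclidean_space m) V \<and>
          homeomorphic_map (top_of_set U) (subtopology (Euclidean_space m) V) \<phi>) \<and>
     (\<exists>L. \<forall>x\<in>U. \<forall>y\<in>U. L2_set (\<lambda>i. \<phi> x i - \<phi> y i) {..<m} \<le> L * dist x y)"

definition lipschitz_manifold :: "nat \<Rightarrow> 'a::metric_space set \<Rightarrow> bool" where
  "lipschitz_manifold m M \<longleftrightarrow>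
     M \<noteq> {} \<and> (\<forall>p\<in>M. \<exists>U \<phi>. p \<in> U \<and> lipschitz_chart m M U \<phi>)"

end

theory Submission
  imports Defs
begin

text \<open>A multiplicatively approximable point only needs one coordinate in the set
  \<open>approximable v\<close> of one-dimensional Jarnik-Besicovitch theory, because the remaining factors are
  at most \<open>1\<close>. Some coordinate \<open>y\<^sub>j\<close> is non-constant along a segment of the chart parallel to the
  last axis, so the pair (\<open>y\<^sub>j\<close>, first \<open>m - 1\<close> chart coordinates) is a Lipschitz map whose
  image contains a box. Given a cover of the set by \<open>W i\<close> of diameter less than \<open>r i\<close>, each slice of
  this box forces the sum of \<open>r i powr s\<close>, over those \<open>i\<close> that meet the slice, to be bounded below
  for each \<open>s < 2 / (1 + v)\<close>. Integrating over the slices, whose parameters for a given \<open>i\<close> fill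
  a cube of side proportional to \<open>r i\<close>, bounds the sum of \<open>r i powr (s + m - 1)\<close> from below.

  The one-dimensional bound is proved without measures: a point avoiding a light cover is found by
  nesting intervals around fractions, always keeping the weight of the cover pieces that meet the
  current interval of length \<open>l\<close> below \<open>l powr s / 256\<close>.\<close>

section \<open>Distance to the nearest integer and reduction to one coordinate\<close>

lemma dist_int_le: "dist_int x \<le> \<bar>x - of_int m\<bar>"
  unfolding dist_int_def by (intro cINF_lower bdd_belowI[of _ 0]) auto

lemma dist_int_nonneg: "0 \<le> dist_int x"
  unfolding dist_int_def by (intro cINF_greatest) auto

lemma dist_int_le_1: "dist_int x \<le> 1"
  using dist_int_le[of x "\<lfloor>x\<rfloor>"] by linarith

definition approximable :: "real \<Rightarrow> real set" where
  "approximable v = {x. infinite {q::nat. 0 < q \<and> dist_int (real q * x) < real q powr (- v)}}"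

lemma mult_approxI:
  fixes y :: "real ^ 'n"
  assumes "y $ j \<in> approximable v"
  shows "y \<in> mult_approx v"
proof -
  have *: "(\<Prod>i\<in>UNIV. dist_int (real q * y $ i)) \<le> dist_int (real q * y $ j)" for q :: nat
  proof -
    have "(\<Prod>i\<in>UNIV. dist_int (real q * y $ i)) =
        dist_int (real q * y $ j) * (\<Prod>i\<in>UNIV - {j}. dist_int (real q * y $ i))"
      by (simp add: prod.remove)
    also have "\<dots> \<le> dist_int (real q * y $ j) * 1"
      by (intro mult_left_mono prod_le_1) (auto simp: dist_int_nonneg dist_int_le_1)
    finally show ?thesis by simp
  qed
  show ?thesis
    using assms * unfolding approximable_def mult_approx_def mem_Collect_eq
    by (elim contrapos_nn finite_subset[rotated]) (use order.strict_trans1 in blast)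
qed

section \<open>Counting fractions and choosing a scale for their denominators\<close>

lemma fractions_in_interval:
  fixes a b :: real
  assumes "0 < q"
  shows "finite {p::int. a \<le> p / q \<and> p / q \<le> b}"
    and "a \<le> b \<Longrightarrow> card {p::int. a \<le> p / q \<and> p / q \<le> b} \<le> q * (b - a) + 1"
proof -
  have eq: "{p::int. a \<le> p / q \<and> p / q \<le> b} = {\<lceil>q * a\<rceil>..\<lfloor>q * b\<rfloor>}"
    using assms by (auto simp: field_simps ceiling_le_iff le_floor_iff)
  then show "finite {p::int. a \<le> p / q \<and> p / q \<le> b}" by simp
  assume "a \<le> b"
  then have "q * a \<le> q * b" using assms by simp
  then show "card {p::int. a \<le> p / q \<and> p / q \<le> b} \<le> q * (b - a) + 1"
    unfolding eq by (simp add: algebra_simps) linarith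
qed

text \<open>Each term is at most the increment of 2 sqrt. Growth below linear is what matters in
  \<open>card_fractions_ge\<close>; this form avoids logarithms.\<close>

lemma sum_inverse_le_sqrt: "(\<Sum>q=1..n. 1 / real q) \<le> 2 * sqrt (real n)"
proof (induction n)
  case (Suc n)
  define s t where "s = sqrt n" and "t = sqrt (Suc n)"
  have st: "t * t = real (Suc n)" "t * t - s * s = 1" "1 \<le> t"
    by (simp_all add: s_def t_def)
  have "1 \<le> 2 * (t - s) * t"
    using st(2) zero_le_square[of "t - s"] by (simp add: algebra_simps)
  also have "\<dots> \<le> 2 * (t - s) * (t * t)"
    using st(3) mult_left_mono[of 1 t t] by (intro mult_left_mono) (auto simp: s_def t_def)
  finally have "1 / real (Suc n) \<le> 2 * t - 2 * s"
    unfolding st(1) by (simp add: field_simps)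
  with Suc show ?case by (simp add: s_def t_def)
qed simp

text \<open>The upper bound on denominators separates distinct values; the lower bound lets balls of
  one radius serve all of them and pushes denominators to infinity. Values are collected rather than
  pairs, so unreduced forms are not counted twice.\<close>

definition fractions :: "nat \<Rightarrow> real \<Rightarrow> real \<Rightarrow> real set" where
  "fractions n a b = {x. \<exists>(p::int) (q::nat). n < q \<and> q \<le> 16 * n \<and> x = p / q \<and> a \<le> x \<and> x \<le> b}"

lemma finite_fractions: "finite (fractions n a b)"
proof -
  have "fractions n a b \<subseteq>
      (\<Union>q\<in>{n<..16 * n}. (\<lambda>p. real_of_int p / real q) ` {p. a \<le> p / real q \<and> p / real q \<le> b})"
    by (auto simp: fractions_def)
  then show ?thesis
    by (rule finite_subset) (auto intro!: fractions_in_interval)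
qed

text \<open>The difference has a nonzero integer numerator over q q', and q q' is at most (16
  n)^2.\<close>

lemma fractions_separated:
  assumes "x \<in> fractions n a b" "y \<in> fractions n a b" "x \<noteq> y"
  shows "1 \<le> \<bar>x - y\<bar> * (256 * n^2)"
proof -
  obtain p p' :: int and q q' :: nat where *: "x = p / q" "y = p' / q'"
    "q \<le> 16 * n" "q' \<le> 16 * n" "0 < q" "0 < q'"
    using assms(1,2) by (auto simp: fractions_def)
  have "x - y = (p * q' - p' * q) / (q * q')"
    using *(5,6) unfolding *(1,2) by (simp add: diff_frac_eq)
  then have d: "\<bar>x - y\<bar> * (q * q') = \<bar>p * q' - p' * q\<bar>"
    using * by (simp add: abs_mult)
  have "p * q' - p' * q \<noteq> 0"
  proof
    assume "p * q' - p' * q = 0"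
    then have "real_of_int (p * q' - p' * q) = 0" by simp
    then show False using assms(3) \<open>x - y = _\<close> by simp
  qed
  then have "1 \<le> \<bar>p * q' - p' * q\<bar>" by linarith
  then have "1 \<le> \<bar>x - y\<bar> * (q * q')" using d by linarith
  also have "\<dots> \<le> \<bar>x - y\<bar> * (real (16 * n) * real (16 * n))"
    using *(3,4) unfolding of_nat_mult by (intro mult_left_mono mult_mono) auto
  finally show ?thesis by (simp add: power2_eq_square)
qed

text \<open>Cells of length \<delta>, counted from the minimum on, contain at most one point each,
  and at most 1 + D / \<delta> of them are reached.\<close>

lemma card_separated_le:
  fixes P :: "real set"
  assumes "finite P" "0 < \<delta>"
    and sep: "\<And>x y. x \<in> P \<Longrightarrow> y \<in> P \<Longrightarrow> x \<noteq> y \<Longrightarrow> \<delta> \<le> \<bar>x - y\<bar>"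
    and D: "\<And>x y. x \<in> P \<Longrightarrow> y \<in> P \<Longrightarrow> \<bar>x - y\<bar> \<le> D"  "0 \<le> D"
  shows "card P \<le> 1 + D / \<delta>"
proof (cases "P = {}")
  case False
  define f where "f x = \<lfloor>(x - Min P) / \<delta>\<rfloor>" for x
  have "inj_on f P"
  proof (rule inj_onI, rule ccontr)
    fix x y assume xy: "x \<in> P" "y \<in> P" "f x = f y" "x \<noteq> y"
    then have "\<bar>(x - Min P) / \<delta> - (y - Min P) / \<delta>\<bar> < 1"
      unfolding f_def by linarith
    then have "\<bar>x - y\<bar> < \<delta>"
      using \<open>0 < \<delta>\<close> by (simp add: diff_divide_distrib[symmetric])
    with sep[OF xy(1,2,4)] show False by simp
  qed
  moreover have "f ` P \<subseteq> {0..\<lfloor>D / \<delta>\<rfloor>}"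
    unfolding f_def using assms False D(1)[OF _ Min_in]
    by (fastforce intro!: floor_mono divide_right_mono dest: abs_le_D1)
  ultimately have "card P \<le> card {0..\<lfloor>D / \<delta>\<rfloor>}"
    by (intro card_inj_on_le) auto
  then have "card P \<le> real (nat (\<lfloor>D / \<delta>\<rfloor> + 1))" by simp
  also have "\<dots> \<le> 1 + D / \<delta>"
    using D(2) assms(2) by simp
  finally show ?thesis .
qed (use assms in simp)

text \<open>Dirichlet's theorem covers the middle half of the interval by balls around fractions with
  denominators up to \<open>16 n\<close>; those with denominator at most \<open>n\<close> cover at most half of it.\<close>

lemma card_fractions_ge:
  fixes a b :: real and n :: nat
  assumes ab: "a < b" and n: "0 < n" "4 / (b - a)^2 \<le> n" "1 / n \<le> 2 * (b - a)"
  shows "2 * n^2 * (b - a) \<le> card (fractions n (a + (b - a) / 8) (b - (b - a) / 8))"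
proof -
  define l where "l = b - a"
  define P where "P = fractions n (a + l / 8) (b - l / 8)"
  define A where "A q = {p::int. a \<le> p / real q \<and> p / real q \<le> b}" for q :: nat
  \<comment> \<open>The radius is Dirichlet's for the bound 16 n. \<open>X\<close> belongs to
    denominators up to n, \<open>Y\<close> to the larger ones, with the radius enlarged to its value
    at q = n.\<close>
  define X where "X = (\<Union>q\<in>{1..n}. \<Union>p\<in>A q. {p / q - 1 / (q * (16 * n))..p / q + 1 / (q * (16 * n))})"
  define Y where "Y = (\<Union>x\<in>P. {x - 1 / (n * (16 * n))..x + 1 / (n * (16 * n))})"
  have l: "l > 0" using ab by (simp add: l_def)
  have finA: "finite (A q)" if "0 < q" for q
    unfolding A_def using that by (intro fractions_in_interval) auto
  have finP: "finite P" by (simp add: P_def finite_fractions)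
  have cover: "{a + l / 4..b - l / 4} \<subseteq> X \<union> Y"
  proof
    fix x assume x: "x \<in> {a + l / 4..b - l / 4}"
    obtain p k :: int where k: "0 < k" "k \<le> int (16 * n)"
      "\<bar>of_int k * x - of_int p\<bar> < 1 / of_int (int (16 * n))"
      by (rule Dirichlet_approx[of "16 * n" x]) (use n(1) in auto)
    define q where "q = nat k"
    have q: "0 < q" "q \<le> 16 * n" "\<bar>q * x - p\<bar> < 1 / (16 * n)"
      using k by (auto simp: q_def)
    have "x - p / q = (q * x - p) / q"
      using q(1) by (simp add: field_simps)
    then have "\<bar>x - p / q\<bar> = \<bar>q * x - p\<bar> / q" by simp
    also have "\<dots> \<le> (1 / (16 * n)) / q"
      using q(3) by (intro divide_right_mono) auto
    finally have d: "\<bar>x - p / q\<bar> \<le> 1 / (q * (16 * n))"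
      by (simp add: mult.commute)
    also have "\<dots> \<le> 1 / (16 * n)"
      using q n(1) by (intro divide_left_mono) auto
    \<comment> \<open>A shift by at most l / 8 from the middle half stays in the window of
      \<open>P\<close>.\<close>
    also have "\<dots> \<le> l / 8"
      using n(3) by (simp add: l_def)
    finally have d': "\<bar>x - p / q\<bar> \<le> l / 8" .
    then have pq: "p / q \<le> x + l / 8" "x - l / 8 \<le> p / q" by linarith+
    show "x \<in> X \<union> Y"
    proof (cases "q \<le> n")
      case True
      have "p \<in> A q" using x ab pq by (simp add: A_def l_def)
      with True q(1) d show ?thesis
        unfolding X_def by (intro UnI1) (force simp: abs_le_iff)
    next
      case False
      have "p / q \<in> P"
        using x pq q False unfolding P_def fractions_def
        by (force intro!: exI[of _ p] exI[of _ q])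
      moreover have "1 / (q * (16 * n)) \<le> 1 / (n * (16 * n))"
        using False n(1) by (intro divide_left_mono mult_right_mono) auto
      with d have "x \<in> {p / q - 1 / (n * (16 * n))..p / q + 1 / (n * (16 * n))}"
        by (auto simp: abs_le_iff)
      ultimately show ?thesis unfolding Y_def by blast
    qed
  qed
  have meas: "measure lborel (\<Union>x\<in>F. {f x - r..f x + r}) \<le> card F * (2 * r)"
      "(\<Union>x\<in>F. {f x - r..f x + r}) \<in> fmeasurable lborel"
    if "finite F" "0 \<le> r" for F :: "'c set" and f :: "'c \<Rightarrow> real" and r :: real
  proof -
    have "measure lborel (\<Union>x\<in>F. {f x - r..f x + r}) \<le> (\<Sum>x\<in>F. measure lborel {f x - r..f x + r})"
      using that by (intro measure_UNION_le) auto
    also have "\<dots> = card F * (2 * r)" using that by simp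
    finally show "measure lborel (\<Union>x\<in>F. {f x - r..f x + r}) \<le> card F * (2 * r)" .
    show "(\<Union>x\<in>F. {f x - r..f x + r}) \<in> fmeasurable lborel"
      using that by (intro fmeasurable.finite_UN fmeasurableI) (auto simp: emeasure_lborel_Icc_eq)
  qed
  \<comment> \<open>The radius cancels the factor q in the count q l + 1, so the main terms add up
    to l / 8; the rest is a harmonic sum, at most l / 8 because n \<ge> 4 / l^2.\<close>
  have "measure lborel X \<le> (\<Sum>q=1..n. measure lborel (\<Union>p\<in>A q. {p / q - 1 / (q * (16 * n))..p / q + 1 / (q * (16 * n))}))"
    unfolding X_def by (rule measure_UNION_le) (auto intro!: sets.finite_UN finA)
  also have "\<dots> \<le> (\<Sum>q=1..n. card (A q) * (2 * (1 / (q * (16 * n)))))"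
    by (intro sum_mono meas finA) auto
  also have "\<dots> \<le> (\<Sum>q=1..n. (q * l + 1) * (2 * (1 / (q * (16 * n)))))"
    using ab by (intro sum_mono mult_right_mono) (auto simp: A_def l_def intro!: fractions_in_interval)
  also have "\<dots> = (\<Sum>q=1..n. l / (8 * n) + (1 / q) * (1 / (8 * n)))"
    using n(1) by (intro sum.cong) (auto simp: field_simps)
  also have "\<dots> = l / 8 + (\<Sum>q=1..n. 1 / q) * (1 / (8 * n))"
    using n(1) by (simp add: sum.distrib sum_divide_distrib)
  also have "\<dots> \<le> l / 8 + 2 * sqrt n * (1 / (8 * n))"
    by (intro add_left_mono mult_right_mono sum_inverse_le_sqrt) auto
  also have "2 * sqrt n * (1 / (8 * n)) \<le> l / 8"
  proof -
    have "(2 / l)^2 \<le> n" using n(2) by (simp add: l_def power_divide)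
    then have "2 / l \<le> sqrt n" by (rule real_le_rsqrt)
    then have "2 / sqrt n \<le> l" using l n(1) by (simp add: field_simps)
    moreover have "2 * sqrt n * (1 / (8 * n)) = 2 / sqrt n / 8"
      using n(1) by (simp add: field_simps)
    ultimately show ?thesis by simp
  qed
  finally have mX: "measure lborel X \<le> l / 4" by simp
  have mY: "measure lborel Y \<le> card P * (2 * (1 / (n * (16 * n))))"
    unfolding Y_def by (intro meas finP) auto
  have fX: "X \<in> fmeasurable lborel"
    unfolding X_def by (intro fmeasurable.finite_UN meas finA) auto
  have fY: "Y \<in> fmeasurable lborel"
    unfolding Y_def by (intro meas finP) auto
  \<comment> \<open>\<open>X\<close> accounts for at most half of the length l / 2, so the balls of
    \<open>Y\<close>, each of length 1 / (8 n^2), have to cover l / 4.\<close>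
  have "l / 2 = measure lborel {a + l / 4..b - l / 4}"
    using l by (simp add: l_def field_simps)
  also have "\<dots> \<le> measure lborel (X \<union> Y)"
    using cover fX fY by (intro measure_mono_fmeasurable fmeasurable.Un) auto
  also have "\<dots> \<le> measure lborel X + measure lborel Y"
    using fX fY by (intro measure_Un_le) auto
  also have "\<dots> \<le> l / 4 + card P / (8 * n^2)"
    using mX mY by (simp add: power2_eq_square)
  finally have "l / 4 \<le> card P / (8 * n^2)" by simp
  then have "2 * n^2 * l \<le> card P" using n(1) by (simp add: field_simps)
  then show ?thesis by (simp add: P_def l_def)
qed

text \<open>The decisive use of s (1 + v) < 2: about n^2 l candidate intervals, each with a
  threshold of order n to the power -(1 + v) s, outweigh any fixed amount for large n. The other
  conditions serve \<open>card_fractions_ge\<close>, and \<open>Q\<close> forces new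
  denominators.\<close>

lemma exists_scale:
  fixes v s a b :: real
  assumes v: "1 \<le> v" and s: "0 < s" "s * (1 + v) < 2" and ab: "a < b"
  obtains n :: nat where "0 < n" "Q < n" "4 / (b - a)^2 \<le> n" "1 / n \<le> 2 * (b - a)"
    "2 * (b - a) powr s < n^2 * (b - a) * ((16 * n) powr (- 1 - v)) powr s"
proof -
  define c where "c = 16 powr (- (1 + v) * s)"
  define X where "X = 2 * (b - a) powr s / ((b - a) * c)"
  have "0 < X" using ab by (simp add: X_def c_def)
  have "(\<lambda>n::nat. real n powr - (2 - s * (1 + v))) \<longlonglongrightarrow> 0"
    using s by (intro tendsto_neg_powr filterlim_real_sequentially) simp
  then have "\<forall>\<^sub>F n::nat in sequentially. real n powr - (2 - s * (1 + v)) < 1 / X"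
    using \<open>0 < X\<close> by (intro order_tendstoD) auto
  then have 1: "\<forall>\<^sub>F n::nat in sequentially.
      2 * (b - a) powr s < n^2 * (b - a) * ((16 * n) powr (- 1 - v)) powr s"
    using eventually_gt_at_top[of 0]
  proof eventually_elim
    case (elim n)
    then have X: "X < real n powr (2 - s * (1 + v))"
      using \<open>0 < X\<close> unfolding powr_minus_divide by (simp add: divide_less_cancel frac_less2 field_simps)
    have "real n powr (2 - s * (1 + v)) * c = n^2 * real n powr (- (1 + v) * s) * c"
      using elim(2) powr_add[of "real n" 2 "- (1 + v) * s"]
      by (simp add: algebra_simps)
    also have "\<dots> = n^2 * ((16 * n) powr (- 1 - v)) powr s"
      using elim(2) by (simp add: c_def powr_powr powr_mult powr_numeral algebra_simps)
    finally show ?case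
      using X ab by (simp add: X_def c_def divide_simps algebra_simps)
  qed
  have 2: "\<forall>\<^sub>F n::nat in sequentially. 4 / (b - a)^2 \<le> n"
    and 3: "\<forall>\<^sub>F n::nat in sequentially. 1 / (2 * (b - a)) \<le> n"
    using filterlim_real_sequentially by (auto simp: filterlim_at_top)
  have "\<forall>\<^sub>F n::nat in sequentially. 0 < n \<and> Q < n \<and> 4 / (b - a)^2 \<le> n \<and> 1 / n \<le> 2 * (b - a) \<and>
      2 * (b - a) powr s < n^2 * (b - a) * ((16 * n) powr (- 1 - v)) powr s"
    using 1 2 3 eventually_gt_at_top[of 0] eventually_gt_at_top[of Q]
    by eventually_elim (use ab in \<open>auto simp: field_simps\<close>)
  then show ?thesis
    using that by (metis (no_types, lifting) eventually_sequentially order_refl)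
qed

section \<open>Nested intervals that avoid a light cover\<close>

lemma dist_int_near_fraction:
  fixes q N :: nat and p :: int and y v :: real
  assumes "0 < q" "q \<le> N" "0 \<le> v" "\<bar>y - p / q\<bar> < real N powr (- 1 - v)"
  shows "dist_int (q * y) < real q powr (- v)"
proof -
  have "real N powr (- 1 - v) \<le> real q powr (- 1 - v)"
    using assms by (intro powr_mono2') auto
  then have "\<bar>y - p / q\<bar> * q < real q powr (- 1 - v) * q"
    using assms by (intro mult_strict_right_mono) auto
  also have "\<dots> = real q powr (- v)"
    using assms(1) powr_add[of "real q" "-1-v" 1] by simp
  also have "\<bar>y - p / q\<bar> * q = \<bar>q * y - p\<bar>"
  proof -
    have "q * y - p = (y - p / q) * q" using assms(1) by (simp add: field_simps)
    then show ?thesis by (simp add: abs_mult)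
  qed
  finally show ?thesis
    using dist_int_le[of "q * y" p] by linarith
qed

text \<open>A piece counts in full however small its overlap with the set. Sizes are kept apart from
  diameters so that a one-point piece can have positive weight. The series is used only under the
  summability required in \<open>small_cover\<close>.\<close>

definition weight :: "(nat \<Rightarrow> real set) \<Rightarrow> (nat \<Rightarrow> real) \<Rightarrow> real \<Rightarrow> real set \<Rightarrow> real" where
  "weight T r s A = (\<Sum>i. if T i \<inter> A \<noteq> {} then r i powr s else 0)"

locale small_cover =
  fixes T :: "nat \<Rightarrow> real set" and r :: "nat \<Rightarrow> real" and s v :: real
  assumes v: "1 \<le> v" and s: "0 < s" "s * (1 + v) < 2"
    and r_nonneg: "0 \<le> r i"
    and diam: "x \<in> T i \<Longrightarrow> y \<in> T i \<Longrightarrow> \<bar>x - y\<bar> \<le> r i"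
    and sumr: "summable (\<lambda>i. r i powr s)"
begin

lemma s_le_1: "s \<le> 1"
proof -
  have "s * 2 \<le> s * (1 + v)" using s v by (intro mult_left_mono) auto
  then show ?thesis using s by linarith
qed

lemma summable_weight: "summable (\<lambda>i. if T i \<inter> A \<noteq> {} then r i powr s else 0)"
  by (rule summable_comparison_test[OF _ sumr]) auto

lemma weight_ge: "T i \<inter> A \<noteq> {} \<Longrightarrow> r i powr s \<le> weight T r s A"
  unfolding weight_def
  using sum_le_suminf[OF summable_weight, of "{i}" A] by simp

text \<open>Centres of intervals met by one piece lie within r i + 2 \<rho> of each other and at
  least 1 / (256 n^2) apart. The condition on \<rho> makes its contribution at most 1.\<close>

lemma card_meeting:
  assumes "0 < n" and \<rho>: "0 \<le> \<rho>" "2 * \<rho> * (256 * n^2) \<le> 1"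
  shows "card {x \<in> fractions n a b. T i \<inter> {x - \<rho>..x + \<rho>} \<noteq> {}} \<le> 2 + 256 * n^2 * r i"
proof -
  have "card {x \<in> fractions n a b. T i \<inter> {x - \<rho>..x + \<rho>} \<noteq> {}} \<le> 1 + (r i + 2 * \<rho>) / (1 / (256 * n^2))"
  proof (rule card_separated_le)
    show "finite {x \<in> fractions n a b. T i \<inter> {x - \<rho>..x + \<rho>} \<noteq> {}}"
      using finite_fractions by simp
    show "1 / (256 * n^2) \<le> \<bar>x - y\<bar>"
      if "x \<in> {x \<in> fractions n a b. T i \<inter> {x - \<rho>..x + \<rho>} \<noteq> {}}"
        "y \<in> {x \<in> fractions n a b. T i \<inter> {x - \<rho>..x + \<rho>} \<noteq> {}}" "x \<noteq> y" for x y
      using fractions_separated[of x n a b y] that assms(1) by (simp add: field_simps)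
    show "\<bar>x - y\<bar> \<le> r i + 2 * \<rho>"
      if xy: "x \<in> {x \<in> fractions n a b. T i \<inter> {x - \<rho>..x + \<rho>} \<noteq> {}}"
        "y \<in> {x \<in> fractions n a b. T i \<inter> {x - \<rho>..x + \<rho>} \<noteq> {}}" for x y
    proof -
      obtain x' y' where "x' \<in> T i" "y' \<in> T i" "\<bar>x - x'\<bar> \<le> \<rho>" "\<bar>y - y'\<bar> \<le> \<rho>"
        using xy by (force simp: abs_le_iff)
      with diam[of x' i y'] show ?thesis by linarith
    qed
  qed (use assms r_nonneg in auto)
  also have "\<dots> \<le> 2 + 256 * n^2 * r i"
    using \<rho> by (simp add: algebra_simps)
  finally show ?thesis by simp
qed

text \<open>Averaging over the candidate fractions: were every candidate interval overloaded, the
  weights truncated at the threshold \<open>K\<close>, so that a single large piece does not count more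
  than once per interval it spoils, would sum to more than the cover allows.\<close>

lemma step:
  assumes ab: "a < b" and w: "weight T r s {a..b} \<le> (b - a) powr s / 256"
  obtains a' b' and q :: nat where "a \<le> a'" "a' < b'" "b' \<le> b" "b' - a' \<le> (b - a) / 2"
    "weight T r s {a'..b'} \<le> (b' - a') powr s / 256"
    "Q < q" "\<And>y::real. y \<in> {a'..b'} \<Longrightarrow> dist_int (q * y) < real q powr (- v)"
proof -
  define l where "l = b - a"
  have l: "0 < l" using ab by (simp add: l_def)
  obtain n :: nat where n: "0 < n" "Q < n" "4 / l^2 \<le> n" "1 / n \<le> 2 * l"
    "2 * l powr s < n^2 * l * ((16 * n) powr (- 1 - v)) powr s"
    unfolding l_def by (rule exists_scale[OF v s ab])
  define P where "P = fractions n (a + l / 8) (b - l / 8)"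
  have card_P: "2 * n^2 * l \<le> card P"
    unfolding P_def l_def using n ab by (intro card_fractions_ge) (auto simp: l_def)
  have fin_P: "finite P" by (simp add: P_def finite_fractions)
  \<comment> \<open>The radius of \<open>dist_int_near_fraction\<close> for N = 16 n becomes the
    full length of the new interval, so the distance to the centre stays strictly below it.\<close>
  define l' where "l' = (16 * n) powr (- 1 - v)"
  define \<rho> where "\<rho> = l' / 2"
  define K where "K = l' powr s / 256"
  have l': "0 < l'" "l' * (256 * n^2) \<le> 1"
  proof -
    show "0 < l'" using n by (simp add: l'_def)
    \<comment> \<open>From v \<ge> 1: the new length does not exceed the guaranteed gap between
      fractions, as \<open>card_meeting\<close> requires.\<close>
    have "l' \<le> (16 * n) powr (- 2)"
      unfolding l'_def using n v by (intro powr_mono) auto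
    also have "\<dots> = 1 / (256 * n^2)"
      using n by (simp add: powr_minus_divide powr_numeral power_mult_distrib)
    finally show "l' * (256 * n^2) \<le> 1" using n by (simp add: field_simps)
  qed
  have \<rho>: "0 < \<rho>" "\<rho> \<le> l / 8"
  proof -
    have "l' * 16 * n \<le> l' * (256 * n^2)"
      using l' n by (simp add: power2_eq_square mult_le_cancel_left)
    then have "l' * n \<le> 1 / 16" using l'(2) by linarith
    moreover have "1 \<le> 2 * l * n" using n by (simp add: field_simps)
    ultimately have "16 * l' * n \<le> 2 * l * n" by linarith
    then show "\<rho> \<le> l / 8" using n l'(1) by (simp add: \<rho>_def)
  qed (use l' in \<open>simp add: \<rho>_def\<close>)
  have K: "0 < K" using l' by (simp add: K_def)
  have "\<exists>x\<in>P. weight T r s {x - \<rho>..x + \<rho>} \<le> K"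
  proof (rule ccontr)
    assume "\<not> ?thesis"
    then have big: "K < weight T r s {x - \<rho>..x + \<rho>}" if "x \<in> P" for x
      using that by force
    define g where "g x i = (if T i \<inter> {x - \<rho>..x + \<rho>} \<noteq> {} then min (r i powr s) K else 0)" for x i
    define h where "h i = (if T i \<inter> {a..b} \<noteq> {} then r i powr s else 0)" for i
    have sum_g: "summable (g x)" for x
      by (rule summable_comparison_test[OF _ sumr]) (use K in \<open>auto simp: g_def\<close>)
    have g_nonneg: "0 \<le> g x i" for x i using K by (simp add: g_def)
    \<comment> \<open>One piece of weight at least \<open>K\<close> already contributes
      \<open>K\<close>; if there is none, truncation changes nothing.\<close>
    have g_ge: "K \<le> suminf (g x)" if "x \<in> P" for x
    proof (cases "\<exists>i. T i \<inter> {x - \<rho>..x + \<rho>} \<noteq> {} \<and> K \<le> r i powr s")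
      case True
      then obtain i where "T i \<inter> {x - \<rho>..x + \<rho>} \<noteq> {}" "K \<le> r i powr s" by blast
      then have "g x i = K" by (simp add: g_def min_absorb2)
      then show ?thesis
        using sum_le_suminf[OF sum_g, of "{i}" x] g_nonneg by simp
    next
      case False
      then have "g x = (\<lambda>i. if T i \<inter> {x - \<rho>..x + \<rho>} \<noteq> {} then r i powr s else 0)"
        by (auto simp: g_def fun_eq_iff)
      then show ?thesis using big[OF that] by (simp add: weight_def)
    qed
    have inside: "{x - \<rho>..x + \<rho>} \<subseteq> {a..b}" if "x \<in> P" for x
      using that \<rho> by (auto simp: P_def fractions_def)
    \<comment> \<open>A piece meets at most 2 + 256 n^2 r i of the intervals. The truncated weight
      is bounded by r i powr s against the 2 and by \<open>K\<close> against the rest, where r i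
      \<le> l powr (1 - s) * r i powr s.\<close>
    define C where "C = 2 + 256 * n^2 * (l powr (1 - s) * K)"
    have termwise: "(\<Sum>x\<in>P. g x i) \<le> C * h i" for i
    proof (cases "T i \<inter> {a..b} = {}")
      case True
      then have "g x i = 0" if "x \<in> P" for x using inside[OF that] by (auto simp: g_def)
      then show ?thesis by (simp add: h_def True)
    next
      case False
      have "r i powr s \<le> l powr s"
        using weight_ge[OF False] w powr_ge_zero[of l s] unfolding l_def by linarith
      then have r_le: "r i \<le> l"
        using powr_less_mono2[of s l "r i"] s l by fastforce
      have r_s: "r i \<le> l powr (1 - s) * r i powr s"
      proof (cases "r i = 0")
        case False
        then have "r i = r i powr (1 - s) * r i powr s"
          using r_nonneg[of i] by (simp add: powr_add[symmetric])
        also have "\<dots> \<le> l powr (1 - s) * r i powr s"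
          using r_le r_nonneg s_le_1 by (intro mult_right_mono powr_mono2) auto
        finally show ?thesis .
      qed simp
      have "(\<Sum>x\<in>P. g x i) = (\<Sum>x\<in>{x \<in> P. T i \<inter> {x - \<rho>..x + \<rho>} \<noteq> {}}. min (r i powr s) K)"
        unfolding g_def using fin_P by (simp add: sum.If_cases Int_def)
      also have "\<dots> = card {x \<in> P. T i \<inter> {x - \<rho>..x + \<rho>} \<noteq> {}} * min (r i powr s) K"
        by simp
      also have "\<dots> \<le> (2 + 256 * n^2 * r i) * min (r i powr s) K"
        unfolding P_def using n l' K card_meeting[of n \<rho> "a + l / 8" "b - l / 8" i]
        by (intro mult_right_mono) (auto simp: \<rho>_def)
      also have "\<dots> = 2 * min (r i powr s) K + 256 * n^2 * r i * min (r i powr s) K"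
        by (simp add: algebra_simps)
      also have "\<dots> \<le> 2 * r i powr s + 256 * n^2 * (l powr (1 - s) * r i powr s) * K"
        using r_s r_nonneg K by (intro add_mono mult_mono) auto
      also have "\<dots> = C * h i" using False by (simp add: C_def h_def algebra_simps)
      finally show ?thesis .
    qed
    have sum_h: "summable h" unfolding h_def by (rule summable_weight)
    have C: "0 \<le> C" using K by (simp add: C_def)
    \<comment> \<open>Double counting against card P * K \<ge> 2 n^2 l K leaves n^2 l K \<le> l powr
      s / 128, which contradicts the choice of n.\<close>
    have "card P * K \<le> (\<Sum>x\<in>P. suminf (g x))"
      using sum_mono[of P "\<lambda>_. K" "\<lambda>x. suminf (g x)"] g_ge by simp
    also have "\<dots> = (\<Sum>i. \<Sum>x\<in>P. g x i)"
      by (rule suminf_sum[symmetric]) (rule sum_g)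
    also have "\<dots> \<le> (\<Sum>i. C * h i)"
      by (intro suminf_le termwise summable_sum sum_g summable_mult sum_h)
    also have "\<dots> = C * weight T r s {a..b}"
      by (simp add: suminf_mult sum_h weight_def h_def[abs_def, symmetric])
    also have "\<dots> \<le> C * (l powr s / 256)"
      using w C by (intro mult_left_mono) (simp_all add: l_def)
    also have "\<dots> = l powr s / 128 + n^2 * K * (l powr (1 - s) * l powr s)"
      by (simp add: C_def algebra_simps)
    also have "l powr (1 - s) * l powr s = l"
      using l by (simp add: powr_add[symmetric])
    finally have "card P * K \<le> l powr s / 128 + n^2 * K * l" .
    moreover have "2 * n^2 * l * K \<le> card P * K"
      using card_P K by (intro mult_right_mono) auto
    moreover have "2 * l powr s < 256 * (n^2 * l * K)"
      using n(5) by (simp add: K_def l'_def)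
    ultimately show False by (simp add: algebra_simps)
  qed
  then obtain x where x: "x \<in> P" "weight T r s {x - \<rho>..x + \<rho>} \<le> K" by blast
  then obtain p :: int and q :: nat where q: "n < q" "q \<le> 16 * n" "x = p / q"
    "a + l / 8 \<le> x" "x \<le> b - l / 8"
    by (auto simp: P_def fractions_def)
  show ?thesis
  proof (rule that)
    show "a \<le> x - \<rho>" "x - \<rho> < x + \<rho>" "x + \<rho> \<le> b" "x + \<rho> - (x - \<rho>) \<le> (b - a) / 2"
      using q(4,5) \<rho> l unfolding l_def by linarith+
    show "weight T r s {x - \<rho>..x + \<rho>} \<le> (x + \<rho> - (x - \<rho>)) powr s / 256"
      using x(2) by (simp add: K_def \<rho>_def)
    show "Q < q" using q n by simp
    show "dist_int (q * y) < real q powr (- v)" if "y \<in> {x - \<rho>..x + \<rho>}" for y :: real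
    proof (rule dist_int_near_fraction)
      have "\<bar>y - p / q\<bar> \<le> \<rho>" using that q by (auto simp: abs_le_iff)
      also have "\<dots> < l'" using l' by (simp add: \<rho>_def)
      finally show "\<bar>y - p / q\<bar> < real (16 * n) powr (- 1 - v)" by (simp add: l'_def)
    qed (use q v in auto)
  qed
qed

text \<open>The intervals from \<open>step\<close> shrink to a point. A piece containing it would
  meet all of them, so its fixed positive weight would stay below powers of lengths tending to
  0.\<close>

lemma uncovered_point:
  assumes ab: "a < b" and w: "(\<Sum>i. r i powr s) \<le> (b - a) powr s / 256"
    and r_pos: "\<And>i. T i \<noteq> {} \<Longrightarrow> 0 < r i"
  obtains x where "x \<in> approximable v" "x \<in> {a..b}" "\<And>i. x \<notin> T i"
proof -
  define good where "good \<equiv> \<lambda>(a'::real, b'::real, q::nat). a' < b' \<and> weight T r s {a'..b'} \<le> (b' - a') powr s / 256"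
  define finer where "finer \<equiv> \<lambda>(a::real, b::real, q::nat) (a'::real, b'::real, q'::nat). a \<le> a' \<and> b' \<le> b \<and> b' - a' \<le> (b - a) / 2 \<and>
     q < q' \<and> (\<forall>y\<in>{a'..b'}. dist_int (q' * y) < real q' powr (- v))"
  have "weight T r s {a..b} \<le> (\<Sum>i. r i powr s)"
    unfolding weight_def by (intro suminf_le summable_weight sumr) auto
  \<comment> \<open>The initial denominator 0 certifies nothing; it makes all later ones
    positive.\<close>
  then have start: "good (a, b, 0)" using ab w by (simp add: good_def)
  have refine: "\<exists>z'. good z' \<and> finer z z'" if good_z: "good z" for z
  proof -
    obtain a1 b1 q1 where z: "z = (a1, b1, q1)" "a1 < b1"
      "weight T r s {a1..b1} \<le> (b1 - a1) powr s / 256"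
      using good_z by (cases z) (auto simp: good_def)
    obtain a' b' and q' :: nat where "a1 \<le> a'" "a' < b'" "b' \<le> b1" "b' - a' \<le> (b1 - a1) / 2"
      "weight T r s {a'..b'} \<le> (b' - a') powr s / 256"
      "q1 < q'" "\<And>y::real. y \<in> {a'..b'} \<Longrightarrow> dist_int (q' * y) < real q' powr (- v)"
      using step[OF z(2,3), of q1] by blast
    then show ?thesis
      by (intro exI[of _ "(a', b', q')"]) (auto simp: good_def finer_def z(1))
  qed
  have "\<exists>f. \<forall>k. (good (f k) \<and> (k = 0 \<longrightarrow> f k = (a, b, 0))) \<and> finer (f k) (f (Suc k))"
    by (rule dependent_nat_choice) (use start refine in auto)
  then obtain f where f: "f 0 = (a, b, 0)" "\<And>k. good (f k)" "\<And>k. finer (f k) (f (Suc k))"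
    by blast
  define A where "A k = fst (f k)" for k
  define B where "B k = fst (snd (f k))" for k
  define q where "q k = snd (snd (f k))" for k
  have f_eq: "f k = (A k, B k, q k)" for k by (simp add: A_def B_def q_def)
  have good: "A k < B k" "weight T r s {A k..B k} \<le> (B k - A k) powr s / 256" for k
    using f(2)[of k] by (auto simp: good_def f_eq)
  have finer: "A k \<le> A (Suc k)" "B (Suc k) \<le> B k" "B (Suc k) - A (Suc k) \<le> (B k - A k) / 2"
    "q k < q (Suc k)" and
    approx: "y \<in> {A (Suc k)..B (Suc k)} \<Longrightarrow> dist_int (q (Suc k) * y) < real (q (Suc k)) powr (- v)" for k and y :: real
    using f(3)[of k] by (auto simp: finer_def f_eq)
  have "incseq A" "decseq B" using finer by (auto intro: incseq_SucI decseq_SucI)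
  have AB: "A j \<le> B k" for j k
    using good(1)[of "max j k"] incseqD[OF \<open>incseq A\<close>, of j "max j k"] decseqD[OF \<open>decseq B\<close>, of k "max j k"]
    by simp
  define x where "x = (SUP k. A k)"
  have x: "x \<in> {A k..B k}" for k
    unfolding x_def using AB by (auto intro!: cSUP_upper cSUP_least bdd_aboveI[of _ "B 0"])
  have len: "B k - A k \<le> (b - a) * (1 / 2) ^ k" for k
  proof (induction k)
    case 0 show ?case using f(1) by (simp add: f_eq)
  next
    case (Suc k) then show ?case using finer(3)[of k] by simp
  qed
  show ?thesis
  proof
    have "strict_mono q" using finer(4) by (simp add: strict_mono_Suc_iff)
    have "q ` {1..} \<subseteq> {q::nat. 0 < q \<and> dist_int (real q * x) < real q powr (- v)}"
    proof safe
      fix k :: nat assume "1 \<le> k"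
      then obtain j where "k = Suc j" by (cases k) auto
      then show "0 < q k" "dist_int (q k * x) < real (q k) powr (- v)"
        using finer(4)[of j] approx x by auto
    qed
    moreover have "infinite (q ` {1..})"
      using \<open>strict_mono q\<close> by (simp add: finite_image_iff strict_mono_imp_inj_on infinite_Ici inj_on_subset)
    ultimately show "x \<in> approximable v"
      unfolding approximable_def using finite_subset by blast
    show "x \<in> {a..b}" using x[of 0] f(1) by (simp add: f_eq)
    fix i
    show "x \<notin> T i"
    proof
      assume "x \<in> T i"
      then have "0 < r i" using r_pos by blast
      have "(\<lambda>k. (b - a) * (1 / 2) ^ k) \<longlonglongrightarrow> (b - a) * 0"
        by (intro tendsto_intros LIMSEQ_power_zero) auto
      then have "\<forall>\<^sub>F k in sequentially. (b - a) * (1 / 2) ^ k < r i"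
        using \<open>0 < r i\<close> by (intro order_tendstoD) auto
      then obtain k where k: "(b - a) * (1 / 2) ^ k < r i"
        by (metis eventually_sequentially order_refl)
      have "r i powr s \<le> weight T r s {A k..B k}"
        using x[of k] \<open>x \<in> T i\<close> by (intro weight_ge) auto
      also have "\<dots> \<le> (B k - A k) powr s" using good(2)[of k] powr_ge_zero[of "B k - A k" s] by linarith
      also have "\<dots> < r i powr s"
        using good(1)[of k] len[of k] k s by (intro powr_less_mono2) auto
      finally show False by simp
    qed
  qed
qed

end

section \<open>Boxes inside a chart\<close>

lemma openin_Euclidean_space_contains_cube:
  assumes V: "openin (Euclidean_space m) V" and p: "p \<in> V"
  obtains e where "0 < e" "\<And>x. (\<And>i. m \<le> i \<Longrightarrow> x i = 0) \<Longrightarrow> (\<And>i. i < m \<Longrightarrow> \<bar>x i - p i\<bar> < e) \<Longrightarrow> x \<in> V"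
proof -
  obtain T where T: "openin (powertop_real UNIV) T" "V = T \<inter> {x. \<forall>i\<ge>m. x i = 0}"
    using V by (auto simp: Euclidean_space_def openin_subtopology)
  obtain X where X: "p \<in> (\<Pi>\<^sub>E i\<in>UNIV. X i)" "\<And>i. open (X i)" "(\<Pi>\<^sub>E i\<in>UNIV. X i) \<subseteq> T"
    using product_topology_open_contains_basis[OF T(1), of p] p T(2) by auto
  have "\<forall>i. \<exists>e>0. \<forall>y. \<bar>y - p i\<bar> < e \<longrightarrow> y \<in> X i"
    using X(1,2) unfolding open_dist dist_real_def by (auto simp: PiE_iff)
  then obtain d where d: "\<And>i. 0 < d i" "\<And>i y. \<bar>y - p i\<bar> < d i \<Longrightarrow> y \<in> X i" by metis
  show ?thesis
  proof (rule that)
    \<comment> \<open>Only the first m coordinates constrain anything, as the others vanish; the 1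
      keeps the minimum defined for m = 0.\<close>
    show "0 < Min (insert 1 (d ` {..<m}))" using d(1) by simp
    fix x assume x: "\<And>i. m \<le> i \<Longrightarrow> x i = 0" "\<And>i. i < m \<Longrightarrow> \<bar>x i - p i\<bar> < Min (insert 1 (d ` {..<m}))"
    have "x i \<in> X i" for i
    proof (rule d(2))
      show "\<bar>x i - p i\<bar> < d i"
      proof (cases "i < m")
        case False
        then have "x i = 0" "p i = 0" using x(1) p T(2) by auto
        then show ?thesis using d(1) by simp
      qed (use x(2)[of i] in simp)
    qed
    then show "x \<in> V" using x(1) X(3) T(2) by auto
  qed
qed

lemma IVT_between:
  fixes h :: "real \<Rightarrow> real"
  assumes "a \<le> b" "continuous_on {a..b} h" "min (h a) (h b) \<le> t" "t \<le> max (h a) (h b)"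
  obtains x where "x \<in> {a..b}" "h x = t"
  using IVT'[of h a t b] IVT2'[of h b t a] assms by (cases "h a \<le> h b") (auto simp: min_def max_def)

text \<open>Only continuity of the inverse chart is available, so its level sets may be wild; but
  fibres of a coordinate along parallel segments are still nonempty by the intermediate value theorem.\<close>

lemma lipschitz_chart_contains_box:
  fixes U :: "(real ^ 'n) set"
  assumes chart: "lipschitz_chart (Suc k) M U \<phi>" and "U \<noteq> {}"
  obtains j p e \<alpha> \<beta> where "0 < e" "\<alpha> < \<beta>"
    "\<And>w t. (\<And>l. l < k \<Longrightarrow> \<bar>w l - p l\<bar> \<le> e) \<Longrightarrow> t \<in> {\<alpha>..\<beta>} \<Longrightarrow>
       \<exists>y\<in>U. y $ j = t \<and> (\<forall>l<k. \<phi> y l = w l)"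
proof -
  let ?E = "Euclidean_space (Suc k)"
  obtain V g where V: "openin ?E V"
    and hom: "homeomorphic_maps (top_of_set U) (subtopology ?E V) \<phi> g"
    using chart unfolding lipschitz_chart_def homeomorphic_map_maps by auto
  have top_V: "topspace (subtopology ?E V) = V"
    using openin_subset[OF V] by auto
  have \<phi>: "\<phi> y \<in> V" if "y \<in> U" for y
    using hom that continuous_map_funspace top_V by (fastforce simp: homeomorphic_maps_def)
  have g: "g x \<in> U" "\<phi> (g x) = x" if "x \<in> V" for x
    using hom that continuous_map_funspace[of "subtopology ?E V" "top_of_set U" g] top_V
    by (auto simp: homeomorphic_maps_def)
  have cont_g: "continuous_map (subtopology ?E V) euclidean g"
    using hom by (auto simp: homeomorphic_maps_def continuous_map_in_subtopology)
  obtain u where "u \<in> U" using \<open>U \<noteq> {}\<close> by blast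
  define p where "p = \<phi> u"
  have p: "p \<in> V" using \<phi> \<open>u \<in> U\<close> by (simp add: p_def)
  have p_zero: "p i = 0" if "Suc k \<le> i" for i
    using p openin_subset[OF V] that by (auto simp: topspace_Euclidean_space)
  obtain e0 where e0: "0 < e0" "\<And>x. (\<And>i. Suc k \<le> i \<Longrightarrow> x i = 0) \<Longrightarrow>
      (\<And>i. i < Suc k \<Longrightarrow> \<bar>x i - p i\<bar> < e0) \<Longrightarrow> x \<in> V"
    using openin_Euclidean_space_contains_cube[OF V p] by metis
  \<comment> \<open>\<open>p'\<close> is \<open>p\<close> moved along the last axis alone. As
    \<open>g\<close> is injective on \<open>V\<close>, some coordinate j of the ambient point
    changes.\<close>
  define b where "b = p k + e0 / 2"
  define p' where "p' = p(k := b)"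
  have p': "p' \<in> V"
    using e0(1) p_zero by (intro e0(2)) (auto simp: p'_def b_def)
  have "p \<noteq> p'" using e0(1) by (auto simp: p'_def b_def fun_eq_iff)
  then have "g p \<noteq> g p'" using g(2)[OF p] g(2)[OF p'] by metis
  then obtain j where j: "g p $ j \<noteq> g p' $ j" by (auto simp: vec_eq_iff)
  define f where "f x = g x $ j" for x
  have cont_f: "continuous_map (subtopology ?E V) euclideanreal f"
    unfolding f_def
    using continuous_map_compose[OF cont_g, of euclideanreal "\<lambda>y. y $ j"]
    by (simp add: o_def continuous_on_component)
  \<comment> \<open>Moving both end values by less than a third of their gap keeps the middle third
    between them, for all nearby parallel segments at once.\<close>
  define d where "d = \<bar>f p - f p'\<bar> / 3"
  have d: "0 < d" using j by (simp add: d_def f_def)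
  have near: "\<exists>e>0. \<forall>x. (\<forall>i\<ge>Suc k. x i = 0) \<longrightarrow> (\<forall>i<Suc k. \<bar>x i - z i\<bar> < e) \<longrightarrow> \<bar>f x - f z\<bar> < d"
    if z: "z \<in> V" for z
  proof -
    define W where "W = {x \<in> topspace (subtopology ?E V). f x \<in> ball (f z) d}"
    have "openin (subtopology ?E V) W"
      unfolding W_def by (rule openin_continuous_map_preimage[OF cont_f]) simp
    then have "openin ?E W" using V openin_trans_full by blast
    moreover have "z \<in> W" unfolding W_def top_V using z d by simp
    ultimately obtain e where "0 < e" "\<And>x. (\<And>i. Suc k \<le> i \<Longrightarrow> x i = 0) \<Longrightarrow>
        (\<And>i. i < Suc k \<Longrightarrow> \<bar>x i - z i\<bar> < e) \<Longrightarrow> x \<in> W"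
      using openin_Euclidean_space_contains_cube by metis
    then show ?thesis
      by (intro exI[of _ e]) (auto simp: W_def dist_real_def abs_minus_commute)
  qed
  obtain e1 where e1: "0 < e1" "\<And>x. (\<forall>i\<ge>Suc k. x i = 0) \<Longrightarrow> (\<forall>i<Suc k. \<bar>x i - p i\<bar> < e1) \<Longrightarrow> \<bar>f x - f p\<bar> < d"
    using near[OF p] by blast
  obtain e2 where e2: "0 < e2" "\<And>x. (\<forall>i\<ge>Suc k. x i = 0) \<Longrightarrow> (\<forall>i<Suc k. \<bar>x i - p' i\<bar> < e2) \<Longrightarrow> \<bar>f x - f p'\<bar> < d"
    using near[OF p'] by blast
  define e where "e = Min {e0, e1, e2} / 2"
  have e: "0 < e" "e < e0" "e < e1" "e < e2" using e0(1) e1(1) e2(1) by (auto simp: e_def min_def)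
  define lo where "lo = min (f p) (f p')"
  show ?thesis
  proof (rule that)
    show "0 < e" by (rule e)
    show "lo + d < lo + 2 * d" using d by simp
    fix w :: "nat \<Rightarrow> real" and t
    assume w: "\<And>l. l < k \<Longrightarrow> \<bar>w l - p l\<bar> \<le> e" and t: "t \<in> {lo + d..lo + 2 * d}"
    define \<gamma> where "\<gamma> \<tau> = (\<lambda>i. if i < k then w i else if i = k then \<tau> else 0)" for \<tau> :: real
    have \<gamma>_V: "\<gamma> \<tau> \<in> V" if "\<tau> \<in> {p k..b}" for \<tau>
    proof (rule e0(2))
      fix i assume "i < Suc k"
      then consider "i < k" | "i = k" by linarith
      then show "\<bar>\<gamma> \<tau> i - p i\<bar> < e0"
      proof cases
        case 1 then show ?thesis using w[of i] e by (simp add: \<gamma>_def)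
      next
        case 2 then show ?thesis using that e0(1) by (auto simp: \<gamma>_def b_def)
      qed
    qed (simp add: \<gamma>_def)
    have "continuous_map (top_of_set {p k..b}) (powertop_real UNIV) \<gamma>"
      unfolding continuous_map_componentwise_UNIV
    proof
      show "continuous_map (top_of_set {p k..b}) euclideanreal (\<lambda>\<tau>. \<gamma> \<tau> i)" for i
        by (cases "i < k"; cases "i = k") (simp_all add: \<gamma>_def)
    qed
    then have "continuous_map (top_of_set {p k..b}) (subtopology ?E V) \<gamma>"
      using \<gamma>_V by (auto simp: Euclidean_space_def continuous_map_in_subtopology \<gamma>_def)
    from continuous_map_compose[OF this cont_f]
    have cont: "continuous_on {p k..b} (f \<circ> \<gamma>)" by simp
    have "\<bar>f (\<gamma> (p k)) - f p\<bar> < d"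
    proof (rule e1(2))
      show "\<forall>i<Suc k. \<bar>\<gamma> (p k) i - p i\<bar> < e1"
        using w e by (auto simp: \<gamma>_def less_Suc_eq intro: le_less_trans)
    qed (simp add: \<gamma>_def)
    moreover have "\<bar>f (\<gamma> b) - f p'\<bar> < d"
    proof (rule e2(2))
      show "\<forall>i<Suc k. \<bar>\<gamma> b i - p' i\<bar> < e2"
        using w e by (auto simp: \<gamma>_def p'_def less_Suc_eq intro: le_less_trans)
    qed (simp add: \<gamma>_def)
    moreover have "lo + 3 * d = max (f p) (f p')" by (simp add: lo_def d_def)
    ultimately have "min (f (\<gamma> (p k))) (f (\<gamma> b)) \<le> t" "t \<le> max (f (\<gamma> (p k))) (f (\<gamma> b))"
      using t unfolding lo_def atLeastAtMost_iff by linarith+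
    moreover have "p k \<le> b" using e0(1) by (simp add: b_def)
    ultimately obtain \<tau> where \<tau>: "\<tau> \<in> {p k..b}" "f (\<gamma> \<tau>) = t"
      using IVT_between[OF _ cont, of t] by auto
    show "\<exists>y\<in>U. y $ j = t \<and> (\<forall>l<k. \<phi> y l = w l)"
    proof (intro bexI conjI allI impI)
      show "g (\<gamma> \<tau>) $ j = t" using \<tau> by (simp add: f_def)
      show "\<phi> (g (\<gamma> \<tau>)) l = w l" if "l < k" for l
        using g(2)[OF \<gamma>_V[OF \<tau>(1)]] that by (simp add: \<gamma>_def)
      show "g (\<gamma> \<tau>) \<in> U" using g(1)[OF \<gamma>_V[OF \<tau>(1)]] .
    qed
  qed
qed

section \<open>Integration over the slices\<close>

interpretation lborel_prod: product_sigma_finite "\<lambda>_::nat. lborel :: real measure"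
  by standard

text \<open>This includes k = 0, where the product is one point of mass 1; hence curves need no
  separate treatment.\<close>

lemma cube_measure:
  fixes c :: "nat \<Rightarrow> real"
  assumes "0 \<le> \<rho>"
  shows "(\<Pi>\<^sub>E l\<in>{..<k}. {c l - \<rho>..c l + \<rho>}) \<in> sets (\<Pi>\<^sub>M l\<in>{..<k}. lborel)"
    and "emeasure (\<Pi>\<^sub>M l\<in>{..<k}. lborel) (\<Pi>\<^sub>E l\<in>{..<k}. {c l - \<rho>..c l + \<rho>}) = ennreal ((2 * \<rho>) ^ k)"
proof -
  show "(\<Pi>\<^sub>E l\<in>{..<k}. {c l - \<rho>..c l + \<rho>}) \<in> sets (\<Pi>\<^sub>M l\<in>{..<k}. lborel)"
    by (intro sets_PiM_I_finite) auto
  show "emeasure (\<Pi>\<^sub>M l\<in>{..<k}. lborel) (\<Pi>\<^sub>E l\<in>{..<k}. {c l - \<rho>..c l + \<rho>}) = ennreal ((2 * \<rho>) ^ k)"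
    using assms by (subst lborel_prod.emeasure_PiM) (auto simp: ennreal_power)
qed

text \<open>Projected to coordinate j, the pieces with index in \<open>I\<close> cover the
  approximable points of the interval, so \<open>uncovered_point\<close> rules out a small sum. The
  form with an indicator is the one to be integrated.\<close>

lemma slice_weight_ge:
  fixes W :: "nat \<Rightarrow> (real ^ 'n) set"
  assumes v: "1 \<le> v" and s: "0 < s" "s * (1 + v) < 2" and "\<alpha> < \<beta>"
    and cover: "\<And>t. t \<in> approximable v \<Longrightarrow> t \<in> {\<alpha>..\<beta>} \<Longrightarrow> \<exists>i\<in>I. \<exists>y\<in>W i. y $ j = t"
    and W: "\<And>i. bounded (W i)" "\<And>i. diameter (W i) < r i"
  shows "ennreal ((\<beta> - \<alpha>) powr s / 256) \<le> (\<Sum>i. ennreal (r i powr s) * indicator I i)"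
proof (rule ccontr)
  assume "\<not> ?thesis"
  then have less: "(\<Sum>i. ennreal (r i powr s) * indicator I i) < ennreal ((\<beta> - \<alpha>) powr s / 256)"
    by simp
  \<comment> \<open>Size 0 removes the indices outside \<open>I\<close> from the series, since 0
    powr s = 0.\<close>
  define r' where "r' i = (if i \<in> I then r i else 0)" for i
  define T where "T i = (if i \<in> I then (\<lambda>y. y $ j) ` W i else {})" for i
  have r: "0 < r i" for i using W(2)[of i] diameter_ge_0[OF W(1)[of i]] by linarith
  have eq: "(\<Sum>i. ennreal (r i powr s) * indicator I i) = (\<Sum>i. ennreal (r' i powr s))"
    by (intro suminf_cong) (simp add: r'_def)
  have sum: "summable (\<lambda>i. r' i powr s)"
    using less unfolding eq by (intro summable_suminf_not_top) auto
  have r'_nonneg: "0 \<le> r' i" for i using r[of i] by (simp add: r'_def)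
  have diam: "\<bar>x - y\<bar> \<le> r' i" if "x \<in> T i" "y \<in> T i" for i x y
  proof -
    from that obtain x' y' where *: "i \<in> I" "x' \<in> W i" "y' \<in> W i" "x = x' $ j" "y = y' $ j"
      by (auto simp: T_def split: if_splits)
    have "\<bar>x - y\<bar> \<le> dist x' y'"
      using component_le_norm_cart[of "x' - y'" j] * by (simp add: dist_norm)
    also have "\<dots> \<le> diameter (W i)" using * W(1) by (intro diameter_bounded_bound) auto
    finally show ?thesis using W(2)[of i] * by (simp add: r'_def)
  qed
  have small: "small_cover T r' s v"
    by (rule small_cover.intro) (fact v s r'_nonneg diam sum)+
  have "ennreal (\<Sum>i. r' i powr s) = (\<Sum>i. ennreal (r' i powr s))"
    by (rule suminf_ennreal2[symmetric]) (simp_all add: sum)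
  also have "\<dots> < ennreal ((\<beta> - \<alpha>) powr s / 256)"
    using less unfolding eq .
  finally have le: "(\<Sum>i. r' i powr s) \<le> (\<beta> - \<alpha>) powr s / 256"
    by (simp add: ennreal_less_iff suminf_nonneg sum)
  have r'_pos: "0 < r' i" if "T i \<noteq> {}" for i
    using that r[of i] by (simp add: r'_def T_def split: if_splits)
  obtain x where x: "x \<in> approximable v" "x \<in> {\<alpha>..\<beta>}" "\<And>i. x \<notin> T i"
    using small_cover.uncovered_point[OF small \<open>\<alpha> < \<beta>\<close> le r'_pos] by blast
  obtain i y where "i \<in> I" "y \<in> W i" "y $ j = x" using cover[OF x(1,2)] by blast
  then show False using x(3)[of i] by (auto simp: T_def)
qed

text \<open>One constant serves covers of every scale. It compares the volume of the parameter box,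
  times the bound for each slice, with the volumes of the cubes of parameters that the pieces can
  affect.\<close>

lemma content_of_chart:
  fixes M :: "(real ^ 'n) set"
  assumes chart: "lipschitz_chart (Suc k) M U \<phi>" and "U \<noteq> {}"
    and v: "1 \<le> v" and s: "0 < s" "s * (1 + v) < 2"
  obtains \<kappa> where "0 < \<kappa>"
    "\<And>W :: nat \<Rightarrow> (real ^ 'n) set. M \<inter> mult_approx v \<subseteq> (\<Union>i. W i) \<Longrightarrow> (\<And>i. bounded (W i)) \<Longrightarrow>
       ennreal \<kappa> \<le> (\<Sum>i. ennreal (diameter (W i) powr (s + k)))"
proof -
  obtain j p e \<alpha> \<beta> where e: "0 < e" and \<alpha>\<beta>: "\<alpha> < \<beta>" and
    box: "\<And>w t. (\<And>l. l < k \<Longrightarrow> \<bar>w l - p l\<bar> \<le> e) \<Longrightarrow> t \<in> {\<alpha>..\<beta>} \<Longrightarrow>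
       \<exists>y\<in>U. y $ j = t \<and> (\<forall>l<k. \<phi> y l = w l)"
    using lipschitz_chart_contains_box[OF assms(1,2)] by metis
  have UM: "U \<subseteq> M"
    using chart openin_subset by (fastforce simp: lipschitz_chart_def)
  obtain L where L: "0 < L" "\<And>x y l. x \<in> U \<Longrightarrow> y \<in> U \<Longrightarrow> l < k \<Longrightarrow> \<bar>\<phi> x l - \<phi> y l\<bar> \<le> L * dist x y"
  proof -
    obtain L0 where L0: "\<forall>x\<in>U. \<forall>y\<in>U. L2_set (\<lambda>i. \<phi> x i - \<phi> y i) {..<Suc k} \<le> L0 * dist x y"
      using chart by (auto simp: lipschitz_chart_def)
    show ?thesis
    proof (rule that)
      fix x y l assume *: "x \<in> U" "y \<in> U" "l < k"
      have "\<phi> x l - \<phi> y l \<le> L0 * dist x y" if "x \<in> U" "y \<in> U" for x y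
        using member_le_L2_set[of "{..<Suc k}" l "\<lambda>i. \<phi> x i - \<phi> y i"] L0 that * by fastforce
      from this[OF *(1,2)] this[OF *(2,1)]
      have "\<bar>\<phi> x l - \<phi> y l\<bar> \<le> L0 * dist x y" by (simp add: dist_commute abs_le_iff)
      also have "\<dots> \<le> max 1 L0 * dist x y" by (intro mult_right_mono) auto
      finally show "\<bar>\<phi> x l - \<phi> y l\<bar> \<le> max 1 L0 * dist x y" .
    qed simp
  qed
  define c where "c = (\<beta> - \<alpha>) powr s / 256"
  have c: "0 < c" using \<alpha>\<beta> by (simp add: c_def)
  define \<kappa> where "\<kappa> = c * (2 * e) ^ k / (2 * L) ^ k"
  show ?thesis
  proof (rule that)
    show "0 < \<kappa>" using c e L by (simp add: \<kappa>_def)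
    fix W :: "nat \<Rightarrow> (real ^ 'n) set"
    assume cover: "M \<inter> mult_approx v \<subseteq> (\<Union>i. W i)" and bdd: "\<And>i. bounded (W i)"
    define t where "t = s + k"
    have t: "0 < t" using s by (simp add: t_def)
    show "ennreal \<kappa> \<le> (\<Sum>i. ennreal (diameter (W i) powr (s + k)))"
    proof (rule ennreal_le_epsilon)
      fix \<eta> :: real assume "0 < \<eta>"
      \<comment> \<open>The enlargement costs \<eta> in total in the sum of t-th powers, and makes
        every size positive even for pieces of diameter 0.\<close>
      define r where "r i = (diameter (W i) powr t + \<eta> * (1/2) ^ Suc i) powr (1 / t)" for i
      have diam_nonneg: "0 \<le> diameter (W i)" for i using bdd diameter_ge_0 by blast
      have \<eta>i: "0 < \<eta> * (1/2) ^ Suc i" for i using \<open>0 < \<eta>\<close> by simp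
      have r_powr: "r i powr t = diameter (W i) powr t + \<eta> * (1/2) ^ Suc i" for i
        unfolding r_def using t \<eta>i[of i] by (simp add: powr_powr add_nonneg_nonneg less_imp_le)
      have r: "diameter (W i) < r i" for i
      proof -
        have "diameter (W i) = (diameter (W i) powr t) powr (1 / t)"
          using t diam_nonneg by (simp add: powr_powr)
        also have "\<dots> < r i"
          unfolding r_def using t \<eta>i[of i] by (intro powr_less_mono2) auto
        finally show ?thesis .
      qed
      have r_pos: "0 < r i" for i using r[of i] diam_nonneg[of i] by linarith
      define Z where "Z i = W i \<inter> U \<inter> mult_approx v" for i
      define u where "u i = (SOME y. y \<in> Z i)" for i
      have u: "u i \<in> Z i" if "Z i \<noteq> {}" for i
        using that by (simp add: u_def some_in_eq)
      \<comment> \<open>By the Lipschitz bound this cube contains the parameters of all points of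
        \<open>Z i\<close>. If \<open>Z i\<close> is empty, its representative \<open>u i\<close> is
        meaningless and the cube is dropped.\<close>
      define C where "C i = (if Z i = {} then {} else
          (\<Pi>\<^sub>E l\<in>{..<k}. {\<phi> (u i) l - L * r i..\<phi> (u i) l + L * r i}))" for i
      define Q where "Q = (\<Pi>\<^sub>E l\<in>{..<k}. {p l - e..p l + e})"
      let ?\<mu> = "\<Pi>\<^sub>M l\<in>{..<k}. (lborel :: real measure)"
      have C_sets: "C i \<in> sets ?\<mu>" for i
        unfolding C_def using L r_pos[of i] by (auto intro!: cube_measure)
      have C_measure: "emeasure ?\<mu> (C i) \<le> ennreal ((2 * (L * r i)) ^ k)" for i
        unfolding C_def using L r_pos[of i] by (auto simp: cube_measure)
      have slice: "ennreal c \<le> (\<Sum>i. ennreal (r i powr s) * indicator (C i) w)" if w: "w \<in> Q" for w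
      proof -
        have "ennreal c \<le> (\<Sum>i. ennreal (r i powr s) * indicator {i. w \<in> C i} i)"
          unfolding c_def
        proof (rule slice_weight_ge[OF v s \<alpha>\<beta>, where W = W and j = j])
          fix x assume x: "x \<in> approximable v" "x \<in> {\<alpha>..\<beta>}"
          have "\<exists>y\<in>U. y $ j = x \<and> (\<forall>l<k. \<phi> y l = w l)"
            using w x(2) by (intro box) (auto simp: Q_def PiE_iff abs_diff_le_iff)
          then obtain y where y: "y \<in> U" "y $ j = x" "\<And>l. l < k \<Longrightarrow> \<phi> y l = w l" by blast
          have "y \<in> mult_approx v" using mult_approxI y(2) x(1) by blast
          then obtain i where i: "y \<in> W i" using y(1) UM cover by blast
          then have "y \<in> Z i" using y \<open>y \<in> mult_approx v\<close> by (simp add: Z_def)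
          then have Z: "Z i \<noteq> {}" and ui: "u i \<in> W i" "u i \<in> U" using u[of i] by (auto simp: Z_def)
          have "\<bar>w l - \<phi> (u i) l\<bar> \<le> L * r i" if "l < k" for l
          proof -
            have "\<bar>w l - \<phi> (u i) l\<bar> \<le> L * dist y (u i)"
              using L(2)[OF y(1) ui(2) that] y(3)[OF that] by simp
            also have "dist y (u i) \<le> r i"
              using diameter_bounded_bound[OF bdd i ui(1)] r[of i] by linarith
            finally show ?thesis using L(1) by simp
          qed
          then have "w \<in> C i" using w Z by (auto simp: C_def Q_def PiE_iff abs_diff_le_iff)
          then show "\<exists>i\<in>{i. w \<in> C i}. \<exists>y\<in>W i. y $ j = x" using i y(2) by blast
        qed (use bdd r in auto)
        then show ?thesis by (simp add: indicator_def)
      qed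
      \<comment> \<open>Exchanging sum and integral turns each indicator into a volume of at most (2
        L r i)^k, which raises the exponent from s to t = s + k.\<close>
      have "ennreal (c * (2 * e) ^ k) = (\<integral>\<^sup>+ w. ennreal c * indicator Q w \<partial>?\<mu>)"
        using e c by (simp add: Q_def cube_measure nn_integral_cmult_indicator ennreal_mult)
      also have "\<dots> \<le> (\<integral>\<^sup>+ w. (\<Sum>i. ennreal (r i powr s) * indicator (C i) w) \<partial>?\<mu>)"
        using slice by (intro nn_integral_mono) (auto simp: indicator_def)
      also have "\<dots> = (\<Sum>i. \<integral>\<^sup>+ w. ennreal (r i powr s) * indicator (C i) w \<partial>?\<mu>)"
        using C_sets by (intro nn_integral_suminf) auto
      also have "\<dots> = (\<Sum>i. ennreal (r i powr s) * emeasure ?\<mu> (C i))"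
        using C_sets by (simp add: nn_integral_cmult_indicator)
      also have "\<dots> \<le> (\<Sum>i. ennreal (r i powr s) * ennreal ((2 * (L * r i)) ^ k))"
        using C_measure by (intro suminf_le mult_left_mono) auto
      also have "\<dots> = (\<Sum>i. ennreal ((2 * L) ^ k) * ennreal (r i powr t))"
      proof (intro suminf_cong)
        fix i
        have "r i powr t = r i powr s * r i ^ k"
          using r_pos[of i] by (simp add: t_def powr_add powr_realpow)
        then show "ennreal (r i powr s) * ennreal ((2 * (L * r i)) ^ k) =
            ennreal ((2 * L) ^ k) * ennreal (r i powr t)"
          using L r_pos[of i] by (simp add: ennreal_mult[symmetric] power_mult_distrib mult_ac)
      qed
      also have "\<dots> = ennreal ((2 * L) ^ k) * (\<Sum>i. ennreal (r i powr t))" by simp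
      finally have *: "ennreal (c * (2 * e) ^ k) \<le> ennreal ((2 * L) ^ k) * (\<Sum>i. ennreal (r i powr t))" .
      have "ennreal \<kappa> = ennreal (c * (2 * e) ^ k) / ennreal ((2 * L) ^ k)"
        unfolding \<kappa>_def using c e L by (intro divide_ennreal[symmetric]) auto
      also have "\<dots> \<le> (\<Sum>i. ennreal (r i powr t))"
        using * L by (intro divide_le_posI_ennreal) (auto simp: mult.commute)
      also have "\<dots> = (\<Sum>i. ennreal (diameter (W i) powr t) + ennreal (\<eta> * (1/2) ^ Suc i))"
        using \<eta>i by (simp add: r_powr ennreal_plus less_imp_le)
      also have "\<dots> = (\<Sum>i. ennreal (diameter (W i) powr t)) + (\<Sum>i. ennreal (\<eta> * (1/2) ^ Suc i))"
        by (rule suminf_add[symmetric]) auto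
      also have "(\<Sum>i. ennreal (\<eta> * (1/2) ^ Suc i)) = ennreal \<eta>"
        using sums_mult[OF power_half_series, of \<eta>] \<open>0 < \<eta>\<close>
        by (intro suminf_ennreal_eq) auto
      finally show "ennreal \<kappa> \<le> (\<Sum>i. ennreal (diameter (W i) powr (s + k))) + ennreal \<eta>"
        by (simp add: t_def)
    qed
  qed
qed

section \<open>From content to Hausdorff dimension\<close>

lemma diam_powr_mono:
  assumes "bounded U" "diameter U \<le> 1" "0 \<le> s" "s < t"
  shows "ennreal (diameter U powr t) \<le> diam_powr s U"
proof (cases "U = {}")
  case False
  have d: "0 \<le> diameter U" using assms(1) by (rule diameter_ge_0)
  \<comment> \<open>This bound settles s = 0, where \<open>diam_powr\<close> is 1 on nonempty sets;
    the next one is for s > 0.\<close>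
  then have "diameter U powr t \<le> 1" using assms by (simp add: powr_le1)
  moreover have "diameter U powr t \<le> diameter U powr s"
    using assms d by (cases "diameter U = 0") (auto intro: powr_mono')
  ultimately show ?thesis
    using False by (auto simp: diam_powr_def intro!: ennreal_leI)
qed simp

theorem theorem5:
  fixes M :: "(real ^ 'n) set" and m :: nat and v :: real
  assumes "lipschitz_manifold m M"
    and "v \<ge> 1"
  shows "hausdorff_dim (M \<inter> mult_approx v) \<ge> ereal (real m - 1 + 2 / (1 + v))"
  unfolding hausdorff_dim_def
proof (intro Inf_greatest, clarify)
  fix s :: real
  assume s: "0 \<le> s" "hausdorff_measure s (M \<inter> mult_approx v) = 0"
  show "ereal (real m - 1 + 2 / (1 + v)) \<le> ereal s"
  proof (cases m)
    case 0
    \<comment> \<open>The claimed bound is at most 0 here, while s is nonnegative.\<close>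
    have "2 / (1 + v) \<le> 1" using assms(2) by simp
    then show ?thesis using 0 s by simp
  next
    case (Suc k)
    show ?thesis
    proof (rule ccontr)
      assume "\<not> ?thesis"
      \<comment> \<open>The maximum secures s' > 0 even when s < k.\<close>
      then have "max 0 (s - k) < 2 / (1 + v)" using Suc assms(2) by simp
      then obtain s' where s': "max 0 (s - k) < s'" "s' < 2 / (1 + v)" using dense by blast
      then have s'2: "0 < s'" "s' * (1 + v) < 2" "s < s' + k"
        using assms(2) by (auto simp: field_simps)
      obtain U \<phi> where U: "lipschitz_chart (Suc k) M U \<phi>" "U \<noteq> {}"
        using assms(1) Suc by (fastforce simp: lipschitz_manifold_def)
      obtain \<kappa> where \<kappa>: "0 < \<kappa>"
        "\<And>W :: nat \<Rightarrow> (real ^ 'n) set. M \<inter> mult_approx v \<subseteq> (\<Union>i. W i) \<Longrightarrow> (\<And>i. bounded (W i)) \<Longrightarrow>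
          ennreal \<kappa> \<le> (\<Sum>i. ennreal (diameter (W i) powr (s' + k)))"
        using content_of_chart[OF U assms(2) s'2(1,2)] by metis
      \<comment> \<open>The scale \<delta> = 1 suffices, since the measure is a supremum over
        \<delta>; diameters at most 1 allow passing from exponent s' + k to the smaller s.\<close>
      have "ennreal \<kappa> \<le> hausdorff_pre 1 s (M \<inter> mult_approx v)"
        unfolding hausdorff_pre_def
      proof (intro Inf_greatest, clarify)
        fix W :: "nat \<Rightarrow> (real ^ 'n) set"
        assume W: "M \<inter> mult_approx v \<subseteq> (\<Union>i. W i)" "\<forall>i. bounded (W i) \<and> diameter (W i) \<le> 1"
        have "ennreal \<kappa> \<le> (\<Sum>i. ennreal (diameter (W i) powr (s' + k)))"
          using W by (intro \<kappa>(2)) auto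
        also have "\<dots> \<le> (\<Sum>i. diam_powr s (W i))"
          using W s s'2 by (intro suminf_le diam_powr_mono) auto
        finally show "ennreal \<kappa> \<le> (\<Sum>i. diam_powr s (W i))" .
      qed
      also have "\<dots> \<le> hausdorff_measure s (M \<inter> mult_approx v)"
        unfolding hausdorff_measure_def by (intro SUP_upper) simp
      finally show False using s \<kappa>(1) by simp
    qed
  qed
qed

end
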